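(* Suppose coherent downlink transmission with MR precoding based on the LMMSE estimator is used, i.e. $\mathbf w_k=\mathbf D_k^{1/2}\hat{\mathbf h}^{\mathrm{lmmse}}_k$ for every UE $k$, where $\mathbf D_k=\mathrm{diag}\big(\rho_{1,k}/\mathbb E\{|\hat h^{\mathrm{lmmse}}_{1,k}|^2\},\dots,\rho_{M,k}/\mathbb E\{|\hat h^{\mathrm{lmmse}}_{M,k}|^2\}\big)$. Then for all UEs $k,l$: $$\mathbb E\{\mathbf w_k^H\mathbf h_k\}=\hat p_k\tau_p\mathrm{tr}(\mathbf D_k^{1/2}\boldsymbol\Omega'_k),$$ $$\mathbb E\{|\mathbf w_l^H\mathbf h_k|^2\}=\hat p_l\tau_p\mathrm{tr}(\mathbf D_l\mathbf R'_k\boldsymbol\Omega'_l)+\begin{cases}T^{(2)}_{k,l},& l\in\mathcal P_k,\\ 0,& l\notin\mathcal P_k,\end{cases}$$ where $$T^{(2)}_{k,l}=\hat p_k\hat p_l\tau_p^2\Big[\mathrm{tr}\big(\mathbf D_l\boldsymbol\Omega'_l\boldsymbol\Lambda'_l(\mathbf R_k^2+2\mathbf L_k\mathbf R_k)\big)+\big|\mathrm{tr}(\mathbf D_l^{1/2}\mathbf R'_k\boldsymbol\Lambda'_l\mathbf R'_l)\big|^2-\mathrm{tr}\big(\mathbf D_l(\mathbf R'_k\boldsymbol\Lambda'_l\mathbf R'_l)^2\big)\Big].$$ Consequently the coherent downlink effective SINR of UE $k$ equals $$\gamma^{\mathrm{dl,lmmse}}_k=\frac{\hat p_k^2\tau_p^2\big|\mathrm{tr}(\mathbf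 D_k^{1/2}\boldsymbol\Omega'_k)\big|^2}{\sum_{l=1}^K\hat p_l\tau_p\mathrm{tr}(\mathbf D_l\mathbf R'_k\boldsymbol\Omega'_l)+\sum_{l\in\mathcal P_k}T^{(2)}_{k,l}-\hat p_k^2\tau_p^2\big|\mathrm{tr}(\mathbf D_k^{1/2}\boldsymbol\Omega'_k)\big|^2+\sigma^2_{\mathrm{dl}}}.$$
   Context: Channels. There are $M$ single-antenna access points (APs) and $K$ single-antenna users (UEs). The channel between AP $m$ and UE $k$ is $h_{m,k}=\bar h_{m,k}e^{j\varphi_{m,k}}+g_{m,k}$, with $\bar h_{m,k}\ge 0$ deterministic, $\varphi_{m,k}$ uniform on $[-\pi,\pi]$, $g_{m,k}\sim\mathcal N_{\mathbb C}(0,\beta_{m,k})$ (circularly symmetric complex Gaussian), $\beta_{m,k}>0$; all $\varphi_{m,k},g_{m,k}$ are mutually independent over $m,k$. Write $\mathbf h_k=[h_{1,k},\dots,h_{M,k}]^T$. Pilots. $\tau_p<K$ is the pilot length. Each UE uses one of $\tau_p$ mutually orthogonal pilot sequences $\boldsymbol\phi_k\in\mathbb C^{\tau_p}$ with $\|\boldsymbol\phi_k\|^2=\tau_p$, with pilot power $\hat p_k>0$. $\mathcal P_k$ is the set of UEs using the same pilot as UE $k$ (including $k$). After correlation with the pilot, AP $m$ has $$y^p_{m,k}=\sum_{l\in\mathcal P_k}\sqrt{\hat p_l}\,\tau_p h_{m,l}+\boldsymbol\phi_k^H\mathbf n^p_m,$$ where the $\mathbf n^p_m\sim\mathcal N_{\mathbb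 C}(\mathbf 0,\sigma^2_{\mathrm{ul}}\mathbf I_{\tau_p})$ are independent over $m$ and independent of all channels, and $\sigma^2_{\mathrm{ul}}>0$. LMMSE estimator: $\hat h^{\mathrm{lmmse}}_{m,k}=\sqrt{\hat p_k}\,\beta'_{m,k}y^p_{m,k}/\lambda'_{m,k}$, with $\beta'_{m,k}=\beta_{m,k}+\bar h_{m,k}^2$, $\lambda'_{m,k}=\sum_{l\in\mathcal P_k}\hat p_l\tau_p\beta'_{m,l}+\sigma^2_{\mathrm{ul}}$; $\hat{\mathbf h}^{\mathrm{lmmse}}_k=[\hat h^{\mathrm{lmmse}}_{1,k},\dots,\hat h^{\mathrm{lmmse}}_{M,k}]^T$. Matrices (all $M\times M$ diagonal): $\mathbf R_k=\mathrm{diag}(\beta_{1,k},\dots,\beta_{M,k})$, $\mathbf L_k=\mathrm{diag}(\bar h_{1,k}^2,\dots,\bar h_{M,k}^2)$, $\mathbf R'_k=\mathbf R_k+\mathbf L_k$, $\boldsymbol\Lambda'_k=\mathrm{diag}(\lambda'_{1,k},\dots,\lambda'_{M,k})^{-1}$, $\boldsymbol\Omega'_k=\mathbf R'_k\boldsymbol\Lambda'_k\mathbf R'_k$. Coherent downlink. The powers $\rho_{m,k}\ge 0$ are deterministic (with $\sum_{l}\rho_{m,l}\le\rho^{\mathrm{dl}}$ for each AP $m$). UE $k$ receives $\mathbf h_k^H\mathbf w_k\varsigma_k+\sum_{l\ne k}\mathbf h_k^H\mathbf w_l\varsigma_l+n^{\mathrm{dl}}_k$ with independent unit-variance data symbols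 $\varsigma_l\sim\mathcal N_{\mathbb C}(0,1)$ and noise $n^{\mathrm{dl}}_k\sim\mathcal N_{\mathbb C}(0,\sigma^2_{\mathrm{dl}})$, $\sigma^2_{\mathrm{dl}}>0$. The coherent downlink effective SINR of UE $k$ (from the use-and-then-forget bound, SE $=\frac{\tau_d}{\tau_c}\log_2(1+\gamma)$) is defined as $$\gamma^{\mathrm{dl,coh}}_k=\frac{|\mathbb E\{\mathbf w_k^H\mathbf h_k\}|^2}{\sum_{l=1}^K\mathbb E\{|\mathbf w_l^H\mathbf h_k|^2\}-|\mathbb E\{\mathbf w_k^H\mathbf h_k\}|^2+\sigma^2_{\mathrm{dl}}}.$$ *)

theory Defs
  imports "HOL-Probability.Probability"
begin

section \<open>Matrices and vectors\<close>

definition diag_mat :: "real^'m \<Rightarrow> real^'m^'m" where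
  "diag_mat v = (\<chi> i j. if i = j then v $ i else 0)"

definition cmat :: "real^'m^'n \<Rightarrow> complex^'m^'n" where
  "cmat A = (\<chi> i j. complex_of_real (A $ i $ j))"

text \<open>The product $x^H y$, conjugate-linear in the first argument.\<close>

definition herm :: "complex^'m \<Rightarrow> complex^'m \<Rightarrow> complex" where
  "herm x y = (\<Sum>i\<in>UNIV. cnj (x $ i) * y $ i)"

section \<open>Circularly symmetric complex Gaussians\<close>

text \<open>
  The parameter \<open>v\<close> is the complex variance, so that each of the two real coordinates
  has variance \<open>v / 2\<close> (note that \<open>normal_density\<close> takes the standard deviation).
\<close>

definition complex_normal :: "'w measure \<Rightarrow> ('w \<Rightarrow> complex) \<Rightarrow> real \<Rightarrow> bool" where
  "complex_normal Pr Z v \<longleftrightarrow>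
     prob_space.indep_var Pr borel (\<lambda>\<omega>. Re (Z \<omega>)) borel (\<lambda>\<omega>. Im (Z \<omega>)) \<and>
     distributed Pr lborel (\<lambda>\<omega>. Re (Z \<omega>)) (normal_density 0 (sqrt (v / 2))) \<and>
     distributed Pr lborel (\<lambda>\<omega>. Im (Z \<omega>)) (normal_density 0 (sqrt (v / 2)))"

text \<open>The vector distribution with mean zero and covariance matrix \<open>v\<close> times the identity.\<close>

definition complex_normal_vec ::
    "'w measure \<Rightarrow> ('w \<Rightarrow> complex^'t) \<Rightarrow> real \<Rightarrow> bool" where
  "complex_normal_vec Pr Z v \<longleftrightarrow>
     prob_space.indep_vars Pr (\<lambda>_. borel) (\<lambda>i \<omega>. Z \<omega> $ i) UNIV \<and>
     (\<forall>i. complex_normal Pr (\<lambda>\<omega>. Z \<omega> $ i) v)"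

section \<open>The cell-free system\<close>

text \<open>
  The finite types \<open>'m\<close>, \<open>'k\<close> and \<open>'t\<close> index the access points, the users, and both the
  coordinates of a pilot sequence and the pilot sequences themselves; thus
  $M$, $K$ and $\tau_p$ are their cardinalities. Sample points have type \<open>'w\<close>.
\<close>

record ('w, 'm, 'k, 't) cf_system =
  Pr :: "'w measure"
  los :: "'m \<Rightarrow> 'k \<Rightarrow> real"                  \<comment> \<open>$\bar h_{m,k}$\<close>
  phase :: "'m \<Rightarrow> 'k \<Rightarrow> 'w \<Rightarrow> real"            \<comment> \<open>$\varphi_{m,k}$\<close>
  scat :: "'m \<Rightarrow> 'k \<Rightarrow> 'w \<Rightarrow> complex"          \<comment> \<open>$g_{m,k}$\<close>
  beta :: "'m \<Rightarrow> 'k \<Rightarrow> real"                 \<comment> \<open>$\beta_{m,k}$\<close>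
  pilot_book :: "'t \<Rightarrow> complex^'t"
  pilot_of :: "'k \<Rightarrow> 't"
  pilot_pow :: "'k \<Rightarrow> real"                  \<comment> \<open>$\hat p_k$\<close>
  pilot_noise :: "'m \<Rightarrow> 'w \<Rightarrow> complex^'t"     \<comment> \<open>$\mathbf n^p_m$\<close>
  var_ul :: real                           \<comment> \<open>$\sigma^2_{\mathrm{ul}}$\<close>
  dl_pow :: "'m \<Rightarrow> 'k \<Rightarrow> real"               \<comment> \<open>$\rho_{m,k}$\<close>
  dl_pow_max :: real                       \<comment> \<open>$\rho^{\mathrm{dl}}$\<close>
  var_dl :: real                           \<comment> \<open>$\sigma^2_{\mathrm{dl}}$\<close>

definition tau_p :: "('w, 'm, 'k, 't::finite) cf_system \<Rightarrow> real" where
  "tau_p S = real CARD('t)"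

definition pilot :: "('w, 'm, 'k, 't::finite) cf_system \<Rightarrow> 'k \<Rightarrow> complex^'t" where
  "pilot S k = pilot_book S (pilot_of S k)"

definition copilot :: "('w, 'm, 'k, 't::finite) cf_system \<Rightarrow> 'k \<Rightarrow> 'k set" where
  "copilot S k = {l. pilot S l = pilot S k}"

definition chan :: "('w, 'm, 'k, 't::finite) cf_system \<Rightarrow> 'm \<Rightarrow> 'k \<Rightarrow> 'w \<Rightarrow> complex" where
  "chan S m k \<omega> = complex_of_real (los S m k) * cis (phase S m k \<omega>) + scat S m k \<omega>"

definition chan_vec ::
    "('w, 'm::finite, 'k, 't::finite) cf_system \<Rightarrow> 'k \<Rightarrow> 'w \<Rightarrow> complex^'m" where
  "chan_vec S k \<omega> = (\<chi> m. chan S m k \<omega>)"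

text \<open>
  In the independence assumption on the phases and the scattering components, the real phases
  are embedded into the complex numbers only to give all members of the family the same type;
  this does not change the sigma-algebras they generate. The noise and the channels, which
  have different types, are independent in the sense of their generated sigma-algebras.
\<close>

locale cf_downlink = prob_space "Pr S"
  for S :: "('w, 'm::finite, 'k::finite, 't::finite) cf_system" +
  assumes los_nonneg: "los S m k \<ge> 0"
    and beta_pos: "beta S m k > 0"
    and phase_uniform: "distributed (Pr S) lborel (phase S m k)
          (\<lambda>x. indicator {-pi..pi} x / measure lborel {-pi..pi})"
    and scat_normal: "complex_normal (Pr S) (scat S m k) (beta S m k)"
    and phase_scat_indep: "indep_vars (\<lambda>_. borel)
          (case_sum (\<lambda>(m, k) \<omega>. complex_of_real (phase S m k \<omega>)) (\<lambda>(m, k) \<omega>. scat S m k \<omega>))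
          (UNIV :: ('m \<times> 'k + 'm \<times> 'k) set)"
    and pilots_fewer: "CARD('t) < CARD('k)"
    and pilots_orthogonal: "s \<noteq> t \<Longrightarrow> herm (pilot_book S s) (pilot_book S t) = 0"
    and pilots_norm: "(norm (pilot_book S t))\<^sup>2 = tau_p S"
    and pilot_pow_pos: "pilot_pow S k > 0"
    and var_ul_pos: "var_ul S > 0"
    and noise_normal: "complex_normal_vec (Pr S) (pilot_noise S m) (var_ul S)"
    and noise_indep: "indep_vars (\<lambda>_. borel) (pilot_noise S) UNIV"
    and noise_chan_indep: "indep_set
          (sets (vimage_algebra (space (Pr S))
             (\<lambda>\<omega>. (\<chi> m. pilot_noise S m \<omega>) :: complex^'t^'m) borel))
          (sets (vimage_algebra (space (Pr S))
             (\<lambda>\<omega>. (\<chi> m k. chan S m k \<omega>) :: complex^'k^'m) borel))"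
    and dl_pow_nonneg: "dl_pow S m k \<ge> 0"
    and dl_pow_budget: "(\<Sum>l\<in>UNIV. dl_pow S m l) \<le> dl_pow_max S"
    and var_dl_pos: "var_dl S > 0"

section \<open>LMMSE channel estimation\<close>

definition pilot_obs ::
    "('w, 'm, 'k, 't::finite) cf_system \<Rightarrow> 'm \<Rightarrow> 'k \<Rightarrow> 'w \<Rightarrow> complex" where
  "pilot_obs S m k \<omega> =
     (\<Sum>l\<in>copilot S k. complex_of_real (sqrt (pilot_pow S l) * tau_p S) * chan S m l \<omega>)
       + herm (pilot S k) (pilot_noise S m \<omega>)"

definition beta' :: "('w, 'm, 'k, 't::finite) cf_system \<Rightarrow> 'm \<Rightarrow> 'k \<Rightarrow> real" where
  "beta' S m k = beta S m k + (los S m k)\<^sup>2"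

definition lambda' :: "('w, 'm, 'k, 't::finite) cf_system \<Rightarrow> 'm \<Rightarrow> 'k \<Rightarrow> real" where
  "lambda' S m k = (\<Sum>l\<in>copilot S k. pilot_pow S l * tau_p S * beta' S m l) + var_ul S"

definition lmmse :: "('w, 'm, 'k, 't::finite) cf_system \<Rightarrow> 'm \<Rightarrow> 'k \<Rightarrow> 'w \<Rightarrow> complex" where
  "lmmse S m k \<omega> =
     complex_of_real (sqrt (pilot_pow S k) * beta' S m k / lambda' S m k) * pilot_obs S m k \<omega>"

definition lmmse_vec ::
    "('w, 'm::finite, 'k, 't::finite) cf_system \<Rightarrow> 'k \<Rightarrow> 'w \<Rightarrow> complex^'m" where
  "lmmse_vec S k \<omega> = (\<chi> m. lmmse S m k \<omega>)"

definition R_mat :: "('w, 'm::finite, 'k, 't::finite) cf_system \<Rightarrow> 'k \<Rightarrow> real^'m^'m" where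
  "R_mat S k = diag_mat (\<chi> m. beta S m k)"

definition L_mat :: "('w, 'm::finite, 'k, 't::finite) cf_system \<Rightarrow> 'k \<Rightarrow> real^'m^'m" where
  "L_mat S k = diag_mat (\<chi> m. (los S m k)\<^sup>2)"

definition R'_mat :: "('w, 'm::finite, 'k, 't::finite) cf_system \<Rightarrow> 'k \<Rightarrow> real^'m^'m" where
  "R'_mat S k = R_mat S k + L_mat S k"

definition Lambda'_mat ::
    "('w, 'm::finite, 'k, 't::finite) cf_system \<Rightarrow> 'k \<Rightarrow> real^'m^'m" where
  "Lambda'_mat S k = matrix_inv (diag_mat (\<chi> m. lambda' S m k))"

definition Omega'_mat ::
    "('w, 'm::finite, 'k, 't::finite) cf_system \<Rightarrow> 'k \<Rightarrow> real^'m^'m" where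
  "Omega'_mat S k = R'_mat S k ** Lambda'_mat S k ** R'_mat S k"

section \<open>Coherent downlink with MR precoding\<close>

definition mr_norm :: "('w, 'm, 'k, 't::finite) cf_system \<Rightarrow> 'm \<Rightarrow> 'k \<Rightarrow> real" where
  "mr_norm S m k =
     dl_pow S m k / prob_space.expectation (Pr S) (\<lambda>\<omega>. (cmod (lmmse S m k \<omega>))\<^sup>2)"

definition D_mat :: "('w, 'm::finite, 'k, 't::finite) cf_system \<Rightarrow> 'k \<Rightarrow> real^'m^'m" where
  "D_mat S k = diag_mat (\<chi> m. mr_norm S m k)"

text \<open>The square root $\mathbf D_k^{1/2}$ of the nonnegative diagonal matrix $\mathbf D_k$.\<close>

definition sqrt_D_mat :: "('w, 'm::finite, 'k, 't::finite) cf_system \<Rightarrow> 'k \<Rightarrow> real^'m^'m" where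
  "sqrt_D_mat S k = diag_mat (\<chi> m. sqrt (mr_norm S m k))"

definition mr_lmmse ::
    "('w, 'm::finite, 'k, 't::finite) cf_system \<Rightarrow> 'k \<Rightarrow> 'w \<Rightarrow> complex^'m" where
  "mr_lmmse S k \<omega> = cmat (sqrt_D_mat S k) *v lmmse_vec S k \<omega>"

text \<open>
  The use-and-then-forget effective SINR for an arbitrary family of precoding vectors. The
  unit-variance data symbols have already been averaged out, so only their precoders appear.
\<close>

definition sinr_dl_coh ::
    "('w, 'm::finite, 'k::finite, 't::finite) cf_system \<Rightarrow>
     ('k \<Rightarrow> 'w \<Rightarrow> complex^'m) \<Rightarrow> 'k \<Rightarrow> real" where
  "sinr_dl_coh S w k =
     (let a = (cmod (prob_space.expectation (Pr S) (\<lambda>\<omega>. herm (w k \<omega>) (chan_vec S k \<omega>))))\<^sup>2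
      in a / ((\<Sum>l\<in>UNIV. prob_space.expectation (Pr S)
                 (\<lambda>\<omega>. (cmod (herm (w l \<omega>) (chan_vec S k \<omega>)))\<^sup>2)) - a + var_dl S))"

definition T2 ::
    "('w, 'm::finite, 'k, 't::finite) cf_system \<Rightarrow> 'k \<Rightarrow> 'k \<Rightarrow> real" where
  "T2 S k l =
     (let A = R'_mat S k ** Lambda'_mat S l ** R'_mat S l
      in pilot_pow S k * pilot_pow S l * (tau_p S)\<^sup>2 *
         (trace (D_mat S l ** Omega'_mat S l ** Lambda'_mat S l **
                   (R_mat S k ** R_mat S k + 2 *\<^sub>R (L_mat S k ** R_mat S k)))
          + \<bar>trace (sqrt_D_mat S l ** A)\<bar>\<^sup>2
          - trace (D_mat S l ** (A ** A))))"

end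

theory Submission
  imports Defs
begin

text \<open>
  Write $w_l^H h_k = \sum_m a_m X_m$ with $X_m = \overline{y^p_{m,l}}\, h_{m,k}$ and real
  weights $a_m$. Distinct access points see independent channels and noise, so the $X_m$ are
  independent and only their first two moments matter. At one access point
  $y^p_{m,l} = \alpha h_{m,k} + Z$, where $\alpha = \sqrt{\hat p_k}\,\tau_p$ if the two users
  share a pilot and $\alpha = 0$ otherwise, and $Z$ is centred and independent of $h_{m,k}$;
  hence everything reduces to the second and fourth absolute moments of the channel.
\<close>

section \<open>Moments of independent complex random variables\<close>

text \<open>With b for \<open>beta'\<close>, the mean of X_m is \<alpha> b. The whole observation
  has second moment tau_p times \<open>lambda'\<close>, so E|Z|^2 = tau_p lambda' - \<alpha>^2 b and
  E|X_m|^2 = \<alpha>^2 (E|h|^4 - b^2) + tau_p lambda' b. The bracket equals beta^2 + 2 los^2 beta,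
  which is the origin of R^2 + 2 L R. It falls short of the Gaussian value b^2 by los^4, because the
  line-of-sight part has a random phase but a fixed modulus. The squared means subtracted in the
  variances of the X_m become the negative trace in \<open>T2\<close>. Two obstacles shape the
  route. The Bochner integral of a nonintegrable function is zero by convention, so moments are
  carried as \<open>has_bochner_integral\<close>, value and integrability together. And noise and
  channels are assumed independent only as whole arrays of different types. Correlating the noise
  with a pilot makes both complex-valued, so they join into one independent family over a sum type.
  The independence of the X_m, and of h and Z, then follows by grouping disjoint blocks of that
  family.\<close>

lemma borel_measurable_cnj [measurable]: "cnj \<in> borel_measurable borel"
  by (intro borel_measurable_continuous_onI continuous_intros)

context prob_space
begin

text \<open>Measurable images of independent variables stay independent, so the expectation factors.
  Keeping \<open>f\<close> and \<open>g\<close> apart from \<open>X\<close> and \<open>Y\<close>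
  lets a single independence fact serve all mixed moments.\<close>

lemma indep_var_expectation_mult:
  fixes f g :: "complex \<Rightarrow> complex"
  assumes "indep_var borel X borel Y"
    and [measurable]: "f \<in> borel_measurable borel" "g \<in> borel_measurable borel"
    and "has_bochner_integral M (\<lambda>\<omega>. f (X \<omega>)) x" "has_bochner_integral M (\<lambda>\<omega>. g (Y \<omega>)) y"
  shows "has_bochner_integral M (\<lambda>\<omega>. f (X \<omega>) * g (Y \<omega>)) (x * y)"
proof -
  have ind: "indep_var borel (\<lambda>\<omega>. f (X \<omega>)) borel (\<lambda>\<omega>. g (Y \<omega>))"
    using indep_var_compose[OF assms(1), of f borel g borel] by (simp add: comp_def)
  have int: "integrable M (\<lambda>\<omega>. f (X \<omega>))" "integrable M (\<lambda>\<omega>. g (Y \<omega>))"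
    using assms by (auto intro: integrable.intros)
  show ?thesis
    using indep_var_lebesgue_integral[OF ind int] indep_var_integrable[OF ind int] assms(4,5)
    by (simp add: has_bochner_integral_iff)
qed

text \<open>The bound x^m \<le> 1 + x^n suffices, since constants are integrable on a probability
  space.\<close>

lemma integrable_cmod_power:
  fixes X :: "'a \<Rightarrow> complex"
  assumes [measurable]: "X \<in> borel_measurable M"
    and "integrable M (\<lambda>\<omega>. cmod (X \<omega>) ^ n)" "m \<le> n"
  shows "integrable M (\<lambda>\<omega>. cmod (X \<omega>) ^ m)"
proof (rule Bochner_Integration.integrable_bound)
  show "integrable M (\<lambda>\<omega>. 1 + cmod (X \<omega>) ^ n)"
    using assms by auto
  have "x ^ m \<le> 1 + x ^ n" if "x \<ge> 0" for x :: real
  proof (cases "x \<le> 1")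
    case True
    then have "x ^ m \<le> 1" using that by (simp add: power_le_one)
    then show ?thesis using that by (simp add: add_increasing2)
  next
    case False
    then have "x ^ m \<le> x ^ n" using assms(3) by (intro power_increasing) auto
    then show ?thesis by simp
  qed
  then show "AE \<omega> in M. norm (cmod (X \<omega>) ^ m) \<le> norm (1 + cmod (X \<omega>) ^ n)"
    by auto
qed measurable

text \<open>Serves mixed powers such as |h|^2 times the conjugate of h: they must have some finite
  mean before a factor of mean zero can remove them.\<close>

lemma integrable_of_cmod_power:
  fixes X Y :: "'a \<Rightarrow> complex"
  assumes [measurable]: "X \<in> borel_measurable M" "Y \<in> borel_measurable M"
    and "integrable M (\<lambda>\<omega>. cmod (X \<omega>) ^ n)" "m \<le> n" "\<And>\<omega>. cmod (Y \<omega>) = cmod (X \<omega>) ^ m"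
  shows "integrable M Y"
  by (rule Bochner_Integration.integrable_bound[OF integrable_cmod_power[OF assms(1,3,4)]])
    (auto simp: assms(5))

lemma has_bochner_integral_Re:
  "has_bochner_integral M f x \<Longrightarrow> has_bochner_integral M (\<lambda>\<omega>. Re (f \<omega>)) (Re x)"
  by (rule has_bochner_integral_bounded_linear[OF bounded_linear_Re])

lemma has_bochner_integral_of_real_complex:
  "has_bochner_integral M f x \<Longrightarrow> has_bochner_integral M (\<lambda>\<omega>. complex_of_real (f \<omega>)) (complex_of_real x)"
  by (rule has_bochner_integral_bounded_linear[OF bounded_linear_of_real])

lemma has_bochner_integral_cnj:
  "has_bochner_integral M f x \<Longrightarrow> has_bochner_integral M (\<lambda>\<omega>. cnj (f \<omega>)) (cnj x)"
  by (rule has_bochner_integral_bounded_linear[OF bounded_linear_cnj])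

section \<open>Independent families: pairs, sums, products, blocks and unions\<close>

lemma indep_vars_imp_indep_var:
  assumes "indep_vars M' X I" "i \<in> I" "j \<in> I" "i \<noteq> j"
  shows "indep_var (M' i) (X i) (M' j) (X j)"
proof -
  have "indep_var (M' i) ((\<lambda>f. f i) \<circ> (\<lambda>\<omega>. restrict (\<lambda>i. X i \<omega>) {i}))
      (M' j) ((\<lambda>f. f j) \<circ> (\<lambda>\<omega>. restrict (\<lambda>i. X i \<omega>) {j}))"
    using assms by (intro indep_var_compose[OF indep_var_restrict[OF assms(1)]]) auto
  then show ?thesis by (simp add: comp_def)
qed

text \<open>The squared modulus is a double sum. Independence factors every off-diagonal term into
  \<mu> i times the conjugate of \<mu> j, and only the diagonal deviates from this pattern.\<close>

lemma expectation_cmod_sum_indep: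
  fixes X :: "'i \<Rightarrow> 'a \<Rightarrow> complex"
  assumes "finite I" and ind: "indep_vars (\<lambda>_. borel) X I"
    and mean: "\<And>i. i \<in> I \<Longrightarrow> has_bochner_integral M (X i) (\<mu> i)"
    and sq: "\<And>i. i \<in> I \<Longrightarrow> has_bochner_integral M (\<lambda>\<omega>. (cmod (X i \<omega>))\<^sup>2) (s i)"
  shows "has_bochner_integral M (\<lambda>\<omega>. (cmod (\<Sum>i\<in>I. a i * X i \<omega>))\<^sup>2)
    ((cmod (\<Sum>i\<in>I. a i * \<mu> i))\<^sup>2 + (\<Sum>i\<in>I. (cmod (a i))\<^sup>2 * (s i - (cmod (\<mu> i))\<^sup>2)))"
proof -
  let ?e = "\<lambda>i j. if i = j then complex_of_real (s i) else \<mu> i * cnj (\<mu> j)"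
  have expand: "complex_of_real ((cmod (\<Sum>i\<in>I. a i * x i))\<^sup>2)
      = (\<Sum>i\<in>I. \<Sum>j\<in>I. (a i * cnj (a j)) * (x i * cnj (x j)))" for x
    unfolding complex_norm_square cnj_sum sum_product by (simp add: mult_ac)
  have e: "has_bochner_integral M (\<lambda>\<omega>. X i \<omega> * cnj (X j \<omega>)) (?e i j)"
    if "i \<in> I" "j \<in> I" for i j
  proof (cases "i = j")
    case True
    then show ?thesis
      using has_bochner_integral_of_real_complex[OF sq[OF that(1)]]
      by (simp flip: complex_norm_square)
  next
    case False
    have "has_bochner_integral M (\<lambda>\<omega>. (\<lambda>x. x) (X i \<omega>) * cnj (X j \<omega>)) (\<mu> i * cnj (\<mu> j))"
      by (intro indep_var_expectation_mult[OF indep_vars_imp_indep_var[OF ind that False]]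
          has_bochner_integral_cnj mean that) auto
    then show ?thesis using False by simp
  qed
  have "has_bochner_integral M (\<lambda>\<omega>. \<Sum>i\<in>I. \<Sum>j\<in>I. (a i * cnj (a j)) * (X i \<omega> * cnj (X j \<omega>)))
      (\<Sum>i\<in>I. \<Sum>j\<in>I. (a i * cnj (a j)) * ?e i j)"
    by (intro has_bochner_integral_sum has_bochner_integral_mult_right e) auto
  \<comment> \<open>Each diagonal entry is split into the squared mean and the variance; the squared
    means complete the double sum to the squared modulus of the total mean.\<close>
  also have "(\<Sum>i\<in>I. \<Sum>j\<in>I. (a i * cnj (a j)) * ?e i j)
      = (\<Sum>i\<in>I. \<Sum>j\<in>I. (a i * cnj (a j)) * (\<mu> i * cnj (\<mu> j))
          + (if i = j then complex_of_real ((cmod (a i))\<^sup>2 * (s i - (cmod (\<mu> i))\<^sup>2)) else 0))"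
    by (intro sum.cong refl)
      (auto simp: complex_norm_square algebra_simps simp del: of_real_power)
  also have "\<dots> = complex_of_real ((cmod (\<Sum>i\<in>I. a i * \<mu> i))\<^sup>2
      + (\<Sum>i\<in>I. (cmod (a i))\<^sup>2 * (s i - (cmod (\<mu> i))\<^sup>2)))"
    unfolding of_real_add expand sum.distrib using \<open>finite I\<close> by simp
  finally show ?thesis
    using has_bochner_integral_Re by (fastforce simp flip: expand simp del: of_real_power)
qed

text \<open>The product is \<alpha>|h|^2 plus h times the conjugate of Z, and its squared modulus is
  \<alpha>^2 |h|^4 + |h|^2 |Z|^2 plus a cross term linear in Z. Independence and E Z = 0 remove
  whatever is linear in Z.\<close>

lemma moments_cnj_mult_indep:
  fixes h Z :: "'a \<Rightarrow> complex"
  assumes ind: "indep_var borel h borel Z"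
    and h0: "has_bochner_integral M h 0" and Z0: "has_bochner_integral M Z 0"
    and h2: "has_bochner_integral M (\<lambda>\<omega>. (cmod (h \<omega>))\<^sup>2) b"
    and h4: "has_bochner_integral M (\<lambda>\<omega>. cmod (h \<omega>) ^ 4) q"
    and Z2: "has_bochner_integral M (\<lambda>\<omega>. (cmod (Z \<omega>))\<^sup>2) z"
  shows "has_bochner_integral M (\<lambda>\<omega>. cnj (complex_of_real \<alpha> * h \<omega> + Z \<omega>) * h \<omega>)
      (complex_of_real (\<alpha> * b))" (is ?mean)
    and "has_bochner_integral M (\<lambda>\<omega>. (cmod (cnj (complex_of_real \<alpha> * h \<omega> + Z \<omega>) * h \<omega>))\<^sup>2)
      (\<alpha>\<^sup>2 * q + z * b)" (is ?square)
proof -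
  have [measurable]: "h \<in> borel_measurable M" "Z \<in> borel_measurable M"
    using ind by (auto dest: indep_var_rv1 indep_var_rv2)
  have 1: "has_bochner_integral M (\<lambda>\<omega>. (\<lambda>x. x) (h \<omega>) * cnj (Z \<omega>)) (0 * cnj 0)"
    by (intro indep_var_expectation_mult[OF ind] h0 has_bochner_integral_cnj Z0) auto
  have "has_bochner_integral M
      (\<lambda>\<omega>. complex_of_real \<alpha> * complex_of_real ((cmod (h \<omega>))\<^sup>2) + h \<omega> * cnj (Z \<omega>))
      (complex_of_real \<alpha> * complex_of_real b + 0 * cnj 0)"
    by (intro has_bochner_integral_add has_bochner_integral_mult_right
        has_bochner_integral_of_real_complex h2 1)
  moreover have "complex_of_real \<alpha> * complex_of_real ((cmod (h \<omega>))\<^sup>2) + h \<omega> * cnj (Z \<omega>)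
      = cnj (complex_of_real \<alpha> * h \<omega> + Z \<omega>) * h \<omega>" for \<omega>
    unfolding complex_norm_square by (simp add: algebra_simps)
  ultimately show ?mean by simp
  \<comment> \<open>The third-order moment \<open>c\<close> only has to exist: it gets multiplied by
    E Z = 0.\<close>
  have "integrable M (\<lambda>\<omega>. complex_of_real ((cmod (h \<omega>))\<^sup>2) * cnj (h \<omega>))"
    by (rule integrable_of_cmod_power[where X=h and n=4 and m=3])
      (use h4 in \<open>auto intro: integrable.intros simp: norm_mult norm_power power2_eq_square power3_eq_cube\<close>)
  then obtain c where c: "has_bochner_integral M (\<lambda>\<omega>. complex_of_real ((cmod (h \<omega>))\<^sup>2) * cnj (h \<omega>)) c"
    by (auto simp: integrable.simps)
  have 2: "has_bochner_integral M
      (\<lambda>\<omega>. (\<lambda>x. complex_of_real ((cmod x)\<^sup>2) * cnj x) (h \<omega>) * (\<lambda>x. x) (Z \<omega>)) (c * 0)"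
    by (intro indep_var_expectation_mult[OF ind] c Z0) auto
  have 3: "has_bochner_integral M
      (\<lambda>\<omega>. (\<lambda>x. complex_of_real ((cmod x)\<^sup>2)) (h \<omega>) * (\<lambda>x. complex_of_real ((cmod x)\<^sup>2)) (Z \<omega>))
      (complex_of_real b * complex_of_real z)"
    by (intro indep_var_expectation_mult[OF ind] has_bochner_integral_of_real_complex h2 Z2) auto
  have "has_bochner_integral M (\<lambda>\<omega>. \<alpha>\<^sup>2 * cmod (h \<omega>) ^ 4
      + Re (complex_of_real ((cmod (h \<omega>))\<^sup>2) * complex_of_real ((cmod (Z \<omega>))\<^sup>2))
      + 2 * \<alpha> * Re (complex_of_real ((cmod (h \<omega>))\<^sup>2) * cnj (h \<omega>) * Z \<omega>))
      (\<alpha>\<^sup>2 * q + Re (complex_of_real b * complex_of_real z) + 2 * \<alpha> * Re (c * 0))"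
    by (intro has_bochner_integral_add has_bochner_integral_mult_right h4
        has_bochner_integral_Re 2[simplified] 3) (use 2 in simp)
  moreover have "\<alpha>\<^sup>2 * cmod x ^ 4
      + Re (complex_of_real ((cmod x)\<^sup>2) * complex_of_real ((cmod y)\<^sup>2))
      + 2 * \<alpha> * Re (complex_of_real ((cmod x)\<^sup>2) * cnj x * y)
      = (cmod (cnj (complex_of_real \<alpha> * x + y) * x))\<^sup>2" for x y
    unfolding norm_mult power_mult_distrib complex_mod_cnj power4_eq_xxxx
      power2_eq_square[symmetric] mult.assoc[symmetric]
    unfolding mult.assoc power2_eq_square[symmetric]
    by (simp only: cmod_power2) (simp add: power2_eq_square algebra_simps)
  moreover have "\<alpha>\<^sup>2 * q + Re (complex_of_real b * complex_of_real z) + 2 * \<alpha> * Re (c * 0)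
      = \<alpha>\<^sup>2 * q + z * b"
    by simp
  ultimately show ?square by (simp only:)
qed

text \<open>Functions of disjoint blocks of an independent family are independent. The last premise
  ties \<open>Y\<close> to blocks and functions pointwise, so a use only has to name
  \<open>K\<close> and \<open>f\<close>.\<close>

lemma indep_vars_group:
  assumes ind: "indep_vars N X I" and K: "\<And>j. j \<in> J \<Longrightarrow> K j \<subseteq> I" and "disjoint_family_on K J"
    and "\<And>j. j \<in> J \<Longrightarrow> f j \<in> measurable (PiM (K j) N) (N' j)"
    and "\<And>j \<omega>. j \<in> J \<Longrightarrow> f j (restrict (\<lambda>i. X i \<omega>) (K j)) = Y j \<omega>"
  shows "indep_vars N' Y J"
proof -
  have "indep_vars N' (\<lambda>j \<omega>. f j (restrict (\<lambda>i. X i \<omega>) (K j))) J"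
    by (rule indep_vars_compose2[OF indep_vars_restrict[OF ind K]]) (use assms in auto)
  then show ?thesis
    using assms(5) by (subst indep_vars_cong[OF refl _ refl, of J Y]) auto
qed

text \<open>Any event about the first family lies in \<open>A\<close> and any about the second in
  \<open>B\<close>. A finite intersection therefore factors first across the two sigma-algebras and
  then inside each family.\<close>

lemma indep_vars_case_sum:
  fixes X :: "'i::finite \<Rightarrow> 'a \<Rightarrow> 'b::topological_space"
    and Y :: "'j::finite \<Rightarrow> 'a \<Rightarrow> 'b"
  assumes X: "indep_vars (\<lambda>_. borel) X UNIV" and Y: "indep_vars (\<lambda>_. borel) Y UNIV"
    and AB: "indep_set (sets A) (sets B)"
    and XA: "\<And>i C. C \<in> sets borel \<Longrightarrow> X i -` C \<inter> space M \<in> sets A"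
    and YB: "\<And>j C. C \<in> sets borel \<Longrightarrow> Y j -` C \<inter> space M \<in> sets B"
  shows "indep_vars (\<lambda>_. borel) (case_sum X Y) UNIV"
proof -
  let ?Z = "case_sum X Y"
  let ?F = "\<lambda>i. {?Z i -` C \<inter> space M | C. C \<in> sets (borel :: 'b measure)}"
  have rv: "?Z i \<in> borel_measurable M" for i
    using X Y by (cases i) (auto simp: indep_vars_def)
  have "indep_sets ?F UNIV"
  \<comment> \<open>Every generating system contains the whole space, so the product rule has to be
    checked only for intersections over the full finite index set.\<close>
  proof (subst indep_sets_finite)
    show "?F i \<subseteq> events" for i using rv by auto
    show "space M \<in> ?F i" for i by (auto intro!: exI[of _ UNIV])
    show "\<forall>E\<in>Pi UNIV ?F. prob (\<Inter>j\<in>UNIV. E j) = (\<Prod>j\<in>UNIV. prob (E j))"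
    proof
      fix E assume "E \<in> Pi UNIV ?F"
      then have "\<forall>j. \<exists>C. C \<in> sets borel \<and> E j = ?Z j -` C \<inter> space M"
        unfolding Pi_iff by blast
      then obtain C where C: "\<And>j. C j \<in> sets borel" "\<And>j. E j = ?Z j -` C j \<inter> space M"
        by metis
      have U: "(UNIV :: ('i + 'j) set) = Inl ` UNIV \<union> Inr ` UNIV"
        by (rule UNIV_sum)
      have EI: "(\<Inter>i. E (Inl i)) \<in> sets A" "(\<Inter>j. E (Inr j)) \<in> sets B"
        unfolding C(2) using C(1) by (auto intro!: sets.finite_INT XA YB simp del: INT_simps)
      have "prob (\<Inter>j\<in>UNIV. E j) = prob ((\<Inter>i. E (Inl i)) \<inter> (\<Inter>j. E (Inr j)))"
        unfolding U by (simp add: INT_Un image_image)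
      also have "\<dots> = prob (\<Inter>i. E (Inl i)) * prob (\<Inter>j. E (Inr j))"
        using AB EI by (rule indep_setD)
      also have "prob (\<Inter>i. E (Inl i)) = (\<Prod>i\<in>UNIV. prob (E (Inl i)))"
        using indep_varsD_finite[OF X, of "\<lambda>i. C (Inl i)"] C by auto
      also have "prob (\<Inter>i. E (Inr i)) = (\<Prod>i\<in>UNIV. prob (E (Inr i)))"
        using indep_varsD_finite[OF Y, of "\<lambda>i. C (Inr i)"] C by auto
      also have "(\<Prod>i\<in>UNIV. prob (E (Inl i))) * (\<Prod>i\<in>UNIV. prob (E (Inr i)))
          = (\<Prod>j\<in>UNIV. prob (E j))"
        unfolding U by (subst prod.union_disjoint) (auto simp: prod.reindex)
      finally show "prob (\<Inter>j\<in>UNIV. E j) = (\<Prod>j\<in>UNIV. prob (E j))" .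
    qed
  qed auto
  then show ?thesis using rv by (simp add: indep_vars_def2)
qed

end

section \<open>Moments of the channel components\<close>

context prob_space
begin

lemma centred_normal_moments:
  assumes D: "distributed M lborel X (normal_density 0 \<sigma>)" and "\<sigma> > 0"
  shows "has_bochner_integral M X 0"
    and "has_bochner_integral M (\<lambda>\<omega>. (X \<omega>)\<^sup>2) (\<sigma>\<^sup>2)"
    and "has_bochner_integral M (\<lambda>\<omega>. X \<omega> ^ 4) (3 * \<sigma> ^ 4)"
proof -
  have *: "has_bochner_integral M (\<lambda>\<omega>. X \<omega> ^ n) i"
    if "has_bochner_integral lborel (\<lambda>x. normal_density 0 \<sigma> x * x ^ n) i" for n i
    using that distributed_integrable[OF D, of "\<lambda>x. x ^ n"]
      distributed_integral[OF D, of "\<lambda>x. x ^ n"]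
    by (simp add: has_bochner_integral_iff normal_density_nonneg)
  show "has_bochner_integral M X 0"
    using *[of 1 0] normal_moment_odd[OF \<open>\<sigma> > 0\<close>, of 0 0] by simp
  show "has_bochner_integral M (\<lambda>\<omega>. (X \<omega>)\<^sup>2) (\<sigma>\<^sup>2)"
    using *[of 2] normal_moment_even[OF \<open>\<sigma> > 0\<close>, of 0 1] by (simp add: fact_numeral)
  \<comment> \<open>The even normal moment of order 2k is (2k)! / ((2/\<sigma>^2)^k k!), here at k =
    2.\<close>
  have "fact 4 / ((2 / \<sigma>\<^sup>2)\<^sup>2 * fact 2) = 3 * \<sigma> ^ 4"
    by (simp add: fact_numeral field_simps)
  then show "has_bochner_integral M (\<lambda>\<omega>. X \<omega> ^ 4) (3 * \<sigma> ^ 4)"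
    using *[of 4] normal_moment_even[OF \<open>\<sigma> > 0\<close>, of 0 2] by simp
qed

text \<open>The real and imaginary parts are independent with variance v/2. In |Z|^4 = x^4 + y^4 + 2
  x^2 y^2 the expectations are 3(v/2)^2 twice and 2(v/2)^2, which add up to 2 v^2.\<close>

lemma complex_normal_moments:
  assumes Z: "complex_normal M Z v" and "v > 0"
  shows "Z \<in> borel_measurable M"
    and "has_bochner_integral M Z 0"
    and "has_bochner_integral M (\<lambda>\<omega>. (cmod (Z \<omega>))\<^sup>2) v"
    and "has_bochner_integral M (\<lambda>\<omega>. cmod (Z \<omega>) ^ 4) (2 * v\<^sup>2)"
proof -
  let ?x = "\<lambda>\<omega>. Re (Z \<omega>)" and ?y = "\<lambda>\<omega>. Im (Z \<omega>)"
  have ind: "indep_var borel ?x borel ?y"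
    and D: "distributed M lborel ?x (normal_density 0 (sqrt (v / 2)))"
      "distributed M lborel ?y (normal_density 0 (sqrt (v / 2)))"
    using Z by (auto simp: complex_normal_def)
  have pos: "sqrt (v / 2) > 0" using \<open>v > 0\<close> by simp
  note x = centred_normal_moments[OF D(1) pos] and y = centred_normal_moments[OF D(2) pos]
  have s2: "(sqrt (v / 2))\<^sup>2 = v / 2" using \<open>v > 0\<close> by simp
  have s4: "sqrt (v / 2) ^ 4 = (v / 2)\<^sup>2"
    using arg_cong[OF s2, of "\<lambda>x. x\<^sup>2"] by simp
  have Z_eq: "Z \<omega> = complex_of_real (?x \<omega>) + \<i> * complex_of_real (?y \<omega>)" for \<omega>
    by (rule complex_eq)
  show "Z \<in> borel_measurable M"
    using indep_var_rv1[OF ind] indep_var_rv2[OF ind] by (simp add: borel_measurable_complex_iff)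
  have "has_bochner_integral M (\<lambda>\<omega>. complex_of_real (?x \<omega>) + \<i> * complex_of_real (?y \<omega>))
      (complex_of_real 0 + \<i> * complex_of_real 0)"
    by (intro has_bochner_integral_add has_bochner_integral_mult_right
        has_bochner_integral_of_real_complex x y)
  then show "has_bochner_integral M Z 0" by (simp flip: Z_eq)
  have "has_bochner_integral M (\<lambda>\<omega>. (?x \<omega>)\<^sup>2 + (?y \<omega>)\<^sup>2) (v / 2 + v / 2)"
    using x(2) y(2) unfolding s2 by (rule has_bochner_integral_add)
  then show "has_bochner_integral M (\<lambda>\<omega>. (cmod (Z \<omega>))\<^sup>2) v" by (simp add: cmod_power2)
  have ind2: "indep_var borel (\<lambda>\<omega>. (?x \<omega>)\<^sup>2) borel (\<lambda>\<omega>. (?y \<omega>)\<^sup>2)"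
    using indep_var_compose[OF ind, of "\<lambda>x. x\<^sup>2" borel "\<lambda>x. x\<^sup>2" borel] by (simp add: comp_def)
  have xy: "has_bochner_integral M (\<lambda>\<omega>. (?x \<omega>)\<^sup>2 * (?y \<omega>)\<^sup>2) (v / 2 * (v / 2))"
    using indep_var_lebesgue_integral[OF ind2] indep_var_integrable[OF ind2] x(2) y(2)
    unfolding s2 by (simp add: has_bochner_integral_iff del: eq_divide_eq_numeral1)
  have "has_bochner_integral M (\<lambda>\<omega>. ?x \<omega> ^ 4 + ?y \<omega> ^ 4 + 2 * ((?x \<omega>)\<^sup>2 * (?y \<omega>)\<^sup>2))
      (3 * (v / 2)\<^sup>2 + 3 * (v / 2)\<^sup>2 + 2 * (v / 2 * (v / 2)))"
    using x(3) y(3) unfolding s4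
    by (intro has_bochner_integral_add has_bochner_integral_mult_right xy)
  moreover have "?x \<omega> ^ 4 + ?y \<omega> ^ 4 + 2 * ((?x \<omega>)\<^sup>2 * (?y \<omega>)\<^sup>2) = cmod (Z \<omega>) ^ 4" for \<omega>
  proof -
    have "cmod (Z \<omega>) ^ 4 = ((cmod (Z \<omega>))\<^sup>2)\<^sup>2" by simp
    then show ?thesis
      unfolding cmod_power2 by (simp add: power2_eq_square power4_eq_xxxx algebra_simps)
  qed
  moreover have "3 * (v / 2)\<^sup>2 + 3 * (v / 2)\<^sup>2 + 2 * (v / 2 * (v / 2)) = 2 * v\<^sup>2"
    by (simp add: power2_eq_square)
  ultimately show "has_bochner_integral M (\<lambda>\<omega>. cmod (Z \<omega>) ^ 4) (2 * v\<^sup>2)" by (simp only:)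
qed

lemma uniform_phase_moment:
  assumes D: "distributed M lborel X (\<lambda>x. indicator {-pi..pi} x / measure lborel {-pi..pi})"
    and "n \<noteq> 0"
  shows "has_bochner_integral M (\<lambda>\<omega>. cis (X \<omega>) ^ n) 0"
proof -
  \<comment> \<open>The density is rewritten as a real function embedded into
    \<open>ennreal\<close>, with the interval length 2 pi made explicit, the form that
    \<open>distributed_integral\<close> takes.\<close>
  have D': "distributed M lborel X (\<lambda>x. ennreal (indicator {-pi..pi} x / (2 * pi)))"
  proof -
    have "(\<lambda>x. indicator {-pi..pi} x / measure lborel {-pi..pi})
        = (\<lambda>x. ennreal (indicator {-pi..pi} x / (2 * pi)))"
      by (auto simp: divide_ennreal indicator_def simp flip: ennreal_1)
    then show ?thesis using D by simp
  qed
  have X[measurable]: "X \<in> borel_measurable M" using D by (auto simp: distributed_def)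
  \<comment> \<open>Cosine and sine of n x are treated alike: a primitive with equal values at both
    ends of the interval makes the integral over it vanish.\<close>
  have *: "has_bochner_integral M (\<lambda>\<omega>. f (X \<omega>)) 0"
    if F: "\<And>x. (F has_real_derivative f x) (at x)" and f: "\<And>x. isCont f x"
      and per: "F pi = F (- pi)" and b: "\<And>x. \<bar>f x\<bar> \<le> 1" for F f :: "real \<Rightarrow> real"
  proof -
    have f': "continuous_on UNIV f" using f by (simp add: continuous_on_eq_continuous_at)
    then have [measurable]: "f \<in> borel_measurable borel" by (rule borel_measurable_continuous_onI)
    have "(\<integral>x. f x * indicator {-pi..pi} x \<partial>lborel) = 0"
      using integral_FTC_Icc_real[of "-pi" pi F f] F f per by simp
    then have "(\<integral>x. (f x * indicator {-pi..pi} x) / (2 * pi) \<partial>lborel) = 0" by simp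
    moreover have "(f x * indicator {-pi..pi} x) / (2 * pi) = indicator {-pi..pi} x / (2 * pi) * f x" for x
      by simp
    ultimately have "(\<integral>x. indicator {-pi..pi} x / (2 * pi) * f x \<partial>lborel) = 0" by (simp only:)
    then have "expectation (\<lambda>\<omega>. f (X \<omega>)) = 0"
      using distributed_integral[OF D', of f] by simp
    moreover have "integrable M (\<lambda>\<omega>. f (X \<omega>))"
      by (rule integrable_const_bound[of _ 1]) (use b in auto)
    ultimately show ?thesis by (simp add: has_bochner_integral_iff)
  qed
  have c: "has_bochner_integral M (\<lambda>\<omega>. cos (n * X \<omega>)) 0"
    using \<open>n \<noteq> 0\<close>
    by (intro *[of "\<lambda>x. sin (n * x) / n"]) (auto intro!: derivative_eq_intros continuous_intros)
  have s: "has_bochner_integral M (\<lambda>\<omega>. sin (n * X \<omega>)) 0"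
    using \<open>n \<noteq> 0\<close>
    by (intro *[of "\<lambda>x. - cos (n * x) / n"]) (auto intro!: derivative_eq_intros continuous_intros)
  have "has_bochner_integral M
      (\<lambda>\<omega>. complex_of_real (cos (n * X \<omega>)) + \<i> * complex_of_real (sin (n * X \<omega>)))
      (complex_of_real 0 + \<i> * complex_of_real 0)"
    by (intro has_bochner_integral_add has_bochner_integral_mult_right
        has_bochner_integral_of_real_complex c s)
  moreover have "complex_of_real (cos t) + \<i> * complex_of_real (sin t) = cis t" for t
    by (simp add: complex_eq_iff)
  ultimately show ?thesis by (simp add: Complex.DeMoivre)
qed

text \<open>With |U| = 1 the powers of |aU + g|^2 can be written using U and U^2 only, inside real
  parts. Each such term factors by independence and has mean zero, so only the terms free of U
  survive.\<close>

lemma rotated_plus_normal_moments: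
  fixes a :: real
  assumes ind: "indep_var borel U borel g"
    and unit: "\<And>\<omega>. cmod (U \<omega>) = 1"
    and U: "has_bochner_integral M U 0" "has_bochner_integral M (\<lambda>\<omega>. (U \<omega>)\<^sup>2) 0"
    and g: "complex_normal M g b" and "b > 0"
  shows "has_bochner_integral M (\<lambda>\<omega>. complex_of_real a * U \<omega> + g \<omega>) 0" (is ?m1)
    and "has_bochner_integral M (\<lambda>\<omega>. (cmod (complex_of_real a * U \<omega> + g \<omega>))\<^sup>2) (b + a\<^sup>2)" (is ?m2)
    and "has_bochner_integral M (\<lambda>\<omega>. cmod (complex_of_real a * U \<omega> + g \<omega>) ^ 4)
      (a ^ 4 + 4 * a\<^sup>2 * b + 2 * b\<^sup>2)" (is ?m4)
proof -
  note gm[measurable] = complex_normal_moments(1)[OF g \<open>b > 0\<close>]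
  note g = complex_normal_moments(2-)[OF g \<open>b > 0\<close>]
  have int: "integrable M (\<lambda>\<omega>. cmod (g \<omega>) ^ 4)" using g(3) by (rule integrable.intros)
  \<comment> \<open>The moments \<open>c2\<close> and \<open>c3\<close> are only required to exist,
    since the factors E U and E U^2 vanish.\<close>
  have "integrable M (\<lambda>\<omega>. (cnj (g \<omega>))\<^sup>2)"
    by (rule integrable_of_cmod_power[OF gm _ int, of _ 2]) (auto simp: norm_power)
  then obtain c2 where c2: "has_bochner_integral M (\<lambda>\<omega>. (cnj (g \<omega>))\<^sup>2) c2"
    by (auto simp: integrable.simps)
  have "integrable M (\<lambda>\<omega>. complex_of_real ((cmod (g \<omega>))\<^sup>2) * cnj (g \<omega>))"
    by (rule integrable_of_cmod_power[OF gm _ int, of _ 3])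
      (auto simp: norm_mult norm_power power2_eq_square power3_eq_cube)
  then obtain c3 where c3: "has_bochner_integral M (\<lambda>\<omega>. complex_of_real ((cmod (g \<omega>))\<^sup>2) * cnj (g \<omega>)) c3"
    by (auto simp: integrable.simps)
  have "has_bochner_integral M (\<lambda>\<omega>. complex_of_real a * U \<omega> + g \<omega>) (complex_of_real a * 0 + 0)"
    by (intro has_bochner_integral_add has_bochner_integral_mult_right U g)
  then show ?m1 by simp
  \<comment> \<open>\<open>?G1\<close> is the coefficient of U in the squared modulus;
    \<open>?G2\<close> and \<open>?G3\<close> are those of U and U^2 in the fourth power.\<close>
  let ?G1 = "\<lambda>x. (2 * complex_of_real a) * cnj x"
  let ?G2 = "\<lambda>x. (4 * complex_of_real a ^ 3) * cnj x
      + (4 * complex_of_real a) * (complex_of_real ((cmod x)\<^sup>2) * cnj x)"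
  let ?G3 = "\<lambda>x. (2 * complex_of_real (a\<^sup>2)) * (cnj x)\<^sup>2"
  have const: "has_bochner_integral M (\<lambda>_. x) x" for x :: real
    by (simp add: has_bochner_integral_iff prob_space)
  have 1: "has_bochner_integral M (\<lambda>\<omega>. (\<lambda>x. x) (U \<omega>) * ?G1 (g \<omega>)) (0 * ((2 * complex_of_real a) * cnj 0))"
    by (intro indep_var_expectation_mult[OF ind] U has_bochner_integral_mult_right
        has_bochner_integral_cnj g) auto
  have 2: "has_bochner_integral M (\<lambda>\<omega>. (\<lambda>x. x) (U \<omega>) * ?G2 (g \<omega>))
      (0 * ((4 * complex_of_real a ^ 3) * cnj 0 + (4 * complex_of_real a) * c3))"
    by (intro indep_var_expectation_mult[OF ind] U has_bochner_integral_mult_right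
        has_bochner_integral_add has_bochner_integral_cnj g c3) auto
  have 3: "has_bochner_integral M (\<lambda>\<omega>. (\<lambda>x. x\<^sup>2) (U \<omega>) * ?G3 (g \<omega>))
      (0 * ((2 * complex_of_real (a\<^sup>2)) * c2))"
    by (intro indep_var_expectation_mult[OF ind] U has_bochner_integral_mult_right c2) auto
  have R: "(Re u)\<^sup>2 + (Im u)\<^sup>2 = 1" if "cmod u = 1" for u
    using that by (metis cmod_power2 one_power2)
  have m2: "(cmod (complex_of_real a * u + x))\<^sup>2 = a\<^sup>2 + (cmod x)\<^sup>2 + Re (u * ?G1 x)"
    if "cmod u = 1" for u x
  proof -
    have "(cmod (complex_of_real a * u + x))\<^sup>2
        = a\<^sup>2 * ((Re u)\<^sup>2 + (Im u)\<^sup>2) + (cmod x)\<^sup>2 + Re (u * ?G1 x)"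
      unfolding cmod_power2 by (simp add: power2_eq_square algebra_simps)
    then show ?thesis unfolding R[OF that] by simp
  qed
  have "has_bochner_integral M (\<lambda>\<omega>. a\<^sup>2 + (cmod (g \<omega>))\<^sup>2 + Re ((\<lambda>x. x) (U \<omega>) * ?G1 (g \<omega>)))
      (a\<^sup>2 + b + Re (0 * ((2 * complex_of_real a) * cnj 0)))"
    by (intro has_bochner_integral_add const g has_bochner_integral_Re 1)
  then show ?m2 by (simp only: m2[OF unit]) (simp add: add.commute)
  have m4: "cmod (complex_of_real a * u + x) ^ 4
      = a ^ 4 + cmod x ^ 4 + (4 * a\<^sup>2) * (cmod x)\<^sup>2 + Re (u * ?G2 x) + Re (u\<^sup>2 * ?G3 x)"
    if u: "cmod u = 1" for u x
  proof -
    let ?t = "Re (u * cnj x)"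
    \<comment> \<open>This trades the square of $\mathrm{Re}(u \bar x)$ for a term linear in $u^2$, whose mean vanishes.\<close>
    have t2: "2 * ?t\<^sup>2 = (cmod x)\<^sup>2 + Re (u\<^sup>2 * (cnj x)\<^sup>2)"
    proof -
      have "2 * ?t\<^sup>2 = ((Re u)\<^sup>2 + (Im u)\<^sup>2) * (cmod x)\<^sup>2 + Re (u\<^sup>2 * (cnj x)\<^sup>2)"
        unfolding cmod_power2 by (simp add: power2_eq_square algebra_simps)
      then show ?thesis unfolding R[OF u] by simp
    qed
    have G1: "Re (u * ?G1 x) = 2 * a * ?t" by (simp add: algebra_simps)
    have G2: "Re (u * ?G2 x) = 4 * a ^ 3 * ?t + 4 * a * (cmod x)\<^sup>2 * ?t"
      by (simp add: algebra_simps power3_eq_cube)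
    have G3: "Re (u\<^sup>2 * ?G3 x) = 2 * a\<^sup>2 * Re (u\<^sup>2 * (cnj x)\<^sup>2)"
    proof -
      have "u\<^sup>2 * ?G3 x = complex_of_real (2 * a\<^sup>2) * (u\<^sup>2 * (cnj x)\<^sup>2)" by (simp add: mult_ac)
      moreover have "Re (complex_of_real r * z) = r * Re z" for r z by simp
      ultimately show ?thesis by (simp only:)
    qed
    have "cmod (complex_of_real a * u + x) ^ 4 = ((cmod (complex_of_real a * u + x))\<^sup>2)\<^sup>2" by simp
    also have "\<dots> = (a\<^sup>2 + (cmod x)\<^sup>2 + 2 * a * ?t)\<^sup>2" unfolding m2[OF u] G1 ..
    also have "\<dots> = a ^ 4 + cmod x ^ 4 + 2 * a\<^sup>2 * (cmod x)\<^sup>2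
        + (4 * a ^ 3 * ?t + 4 * a * (cmod x)\<^sup>2 * ?t) + 2 * a\<^sup>2 * (2 * ?t\<^sup>2)"
      by (simp add: power2_eq_square power3_eq_cube power4_eq_xxxx algebra_simps del: times_complex.sel)
    finally show ?thesis unfolding G2 G3 t2 by (simp add: algebra_simps del: times_complex.sel)
  qed
  have "has_bochner_integral M (\<lambda>\<omega>. a ^ 4 + cmod (g \<omega>) ^ 4 + (4 * a\<^sup>2) * (cmod (g \<omega>))\<^sup>2
        + Re ((\<lambda>x. x) (U \<omega>) * ?G2 (g \<omega>)) + Re ((\<lambda>x. x\<^sup>2) (U \<omega>) * ?G3 (g \<omega>)))
      (a ^ 4 + 2 * b\<^sup>2 + (4 * a\<^sup>2) * b
        + Re (0 * ((4 * complex_of_real a ^ 3) * cnj 0 + (4 * complex_of_real a) * c3))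
        + Re (0 * ((2 * complex_of_real (a\<^sup>2)) * c2)))"
    by (intro has_bochner_integral_add const g has_bochner_integral_mult_right
        has_bochner_integral_Re 2 3)
  then show ?m4 by (simp only: m4[OF unit]) (simp add: algebra_simps)
qed

end

section \<open>Diagonal matrices\<close>

lemma cmat_diag_mat_mult_vec: "(cmat (diag_mat v) *v x) $ i = complex_of_real (v $ i) * x $ i"
  by (simp add: cmat_def diag_mat_def matrix_vector_mult_def if_distrib[of complex_of_real]
      if_distrib[of "\<lambda>x. x * _"] cong: if_cong)

lemma diag_mat_mult: "diag_mat u ** diag_mat v = diag_mat (\<chi> i. u $ i * v $ i)"
  by (simp add: diag_mat_def matrix_matrix_mult_def vec_eq_iff if_distrib[of "\<lambda>x. x * _"]
      sum.delta cong: if_cong)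

lemma diag_mat_add: "diag_mat u + diag_mat v = diag_mat (\<chi> i. u $ i + v $ i)"
  by (simp add: diag_mat_def vec_eq_iff)

lemma diag_mat_scaleR: "c *\<^sub>R diag_mat u = diag_mat (c *\<^sub>R u)"
  by (simp add: diag_mat_def vec_eq_iff)

lemma trace_diag_mat: "trace (diag_mat v) = (\<Sum>i\<in>UNIV. v $ i)"
  by (simp add: trace_def diag_mat_def)

text \<open>\<open>matrix_inv\<close> is a choice among two-sided inverses. Exhibiting one gives the
  chosen matrix its left-inverse property, and multiplying by the exhibited one on the right
  identifies the two.\<close>

lemma matrix_inv_diag_mat:
  assumes "\<And>i. v $ i \<noteq> 0"
  shows "matrix_inv (diag_mat v) = diag_mat (\<chi> i. 1 / v $ i)"
proof -
  have one: "diag_mat (\<chi> i. 1) = (mat 1 :: real^'a^'a)"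
    by (simp add: diag_mat_def mat_def vec_eq_iff)
  have r: "diag_mat v ** diag_mat (\<chi> i. 1 / v $ i) = mat 1"
    and l: "diag_mat (\<chi> i. 1 / v $ i) ** diag_mat v = mat 1"
    using assms by (simp_all add: diag_mat_mult one)
  then have "invertible (diag_mat v)" unfolding invertible_def by blast
  then have "matrix_inv (diag_mat v) ** diag_mat v = mat 1"
    unfolding matrix_inv_def invertible_def by (rule someI2_ex) simp
  then have "matrix_inv (diag_mat v) ** diag_mat v ** diag_mat (\<chi> i. 1 / v $ i)
      = diag_mat (\<chi> i. 1 / v $ i)" by simp
  then show ?thesis by (simp add: matrix_mul_assoc[symmetric] r)
qed

section \<open>The channels and the pilot observations\<close>

lemma borel_measurable_cis [measurable]: "cis \<in> borel_measurable borel"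
  by (intro borel_measurable_continuous_onI continuous_intros)

lemma continuous_on_herm_right: "continuous_on A f \<Longrightarrow> continuous_on A (\<lambda>x. herm u (f x))"
  unfolding herm_def by (intro continuous_intros)

context cf_downlink
begin

text \<open>Each block pairs one phase with its scattering term; \<open>Re\<close> undoes the
  embedding of the phase into the complex numbers.\<close>

lemma chan_indep: "indep_vars (\<lambda>_. borel) (\<lambda>(m, k). chan S m k) UNIV"
  by (rule indep_vars_group[OF phase_scat_indep, where K = "\<lambda>j. {Inl j, Inr j}"
        and f = "\<lambda>(m, k) x. complex_of_real (los S m k) * cis (Re (x (Inl (m, k)))) + x (Inr (m, k))"])
    (auto simp: disjoint_family_on_def chan_def)

text \<open>The fourth moment is written as the squared second moment plus an excess, because that
  excess is the diagonal entry of R^2 + 2 L R.\<close>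

lemma chan_moments:
  shows "has_bochner_integral (Pr S) (chan S m k) 0"
    and "has_bochner_integral (Pr S) (\<lambda>\<omega>. (cmod (chan S m k \<omega>))\<^sup>2) (beta' S m k)"
    and "has_bochner_integral (Pr S) (\<lambda>\<omega>. cmod (chan S m k \<omega>) ^ 4)
      ((beta' S m k)\<^sup>2 + (beta S m k)\<^sup>2 + 2 * (los S m k)\<^sup>2 * beta S m k)"
proof -
  have "indep_var borel (\<lambda>\<omega>. complex_of_real (phase S m k \<omega>)) borel (scat S m k)"
    using indep_vars_imp_indep_var[OF phase_scat_indep, of "Inl (m, k)" "Inr (m, k)"] by simp
  then have "indep_var borel ((\<lambda>x. cis (Re x)) \<circ> (\<lambda>\<omega>. complex_of_real (phase S m k \<omega>)))
      borel ((\<lambda>x. x) \<circ> scat S m k)"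
    by (rule indep_var_compose) measurable
  then have ind: "indep_var borel (\<lambda>\<omega>. cis (phase S m k \<omega>)) borel (scat S m k)"
    by (simp only: comp_def Re_complex_of_real)
  have U: "cmod (cis (phase S m k \<omega>)) = 1" for \<omega> by simp
  have U1: "has_bochner_integral (Pr S) (\<lambda>\<omega>. cis (phase S m k \<omega>)) 0"
    using uniform_phase_moment[OF phase_uniform[of m k], of 1] by simp
  have U2: "has_bochner_integral (Pr S) (\<lambda>\<omega>. (cis (phase S m k \<omega>))\<^sup>2) 0"
    using uniform_phase_moment[OF phase_uniform[of m k], of 2] by simp
  note moments = rotated_plus_normal_moments[OF ind U U1 U2 scat_normal beta_pos, of "los S m k"]
  have chan_eq: "chan S m k = (\<lambda>\<omega>. complex_of_real (los S m k) * cis (phase S m k \<omega>) + scat S m k \<omega>)"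
    by (simp add: chan_def fun_eq_iff)
  show "has_bochner_integral (Pr S) (chan S m k) 0"
    "has_bochner_integral (Pr S) (\<lambda>\<omega>. (cmod (chan S m k \<omega>))\<^sup>2) (beta' S m k)"
    unfolding chan_eq beta'_def by (rule moments)+
  have q: "(beta' S m k)\<^sup>2 + (beta S m k)\<^sup>2 + 2 * (los S m k)\<^sup>2 * beta S m k
      = los S m k ^ 4 + 4 * (los S m k)\<^sup>2 * beta S m k + 2 * (beta S m k)\<^sup>2"
    by (simp add: beta'_def power2_eq_square power4_eq_xxxx algebra_simps)
  show "has_bochner_integral (Pr S) (\<lambda>\<omega>. cmod (chan S m k \<omega>) ^ 4)
      ((beta' S m k)\<^sup>2 + (beta S m k)\<^sup>2 + 2 * (los S m k)\<^sup>2 * beta S m k)"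
    unfolding chan_eq q by (rule moments)
qed

text \<open>The noise coordinates are independent and centred, so the variances add up with weights
  whose sum is the squared pilot norm \<open>tau_p\<close>.\<close>

lemma correlated_noise_moments:
  shows "has_bochner_integral (Pr S) (\<lambda>\<omega>. herm (pilot S l) (pilot_noise S m \<omega>)) 0"
    and "has_bochner_integral (Pr S) (\<lambda>\<omega>. (cmod (herm (pilot S l) (pilot_noise S m \<omega>)))\<^sup>2)
      (tau_p S * var_ul S)"
proof -
  have ind: "indep_vars (\<lambda>_. borel) (\<lambda>i \<omega>. pilot_noise S m \<omega> $ i) UNIV"
    and n: "complex_normal (Pr S) (\<lambda>\<omega>. pilot_noise S m \<omega> $ i) (var_ul S)" for i
    using noise_normal by (auto simp: complex_normal_vec_def)
  note * = complex_normal_moments[OF n var_ul_pos]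
  have "has_bochner_integral (Pr S) (\<lambda>\<omega>. herm (pilot S l) (pilot_noise S m \<omega>))
      (\<Sum>i\<in>UNIV. cnj (pilot S l $ i) * 0)"
    unfolding herm_def by (intro has_bochner_integral_sum has_bochner_integral_mult_right *)
  then show "has_bochner_integral (Pr S) (\<lambda>\<omega>. herm (pilot S l) (pilot_noise S m \<omega>)) 0"
    by simp
  have "(\<Sum>i\<in>UNIV. (cmod (pilot S l $ i))\<^sup>2) = tau_p S"
    using pilots_norm[of "pilot_of S l"]
    by (simp add: pilot_def norm_vec_def L2_set_def sum_nonneg)
  then show "has_bochner_integral (Pr S) (\<lambda>\<omega>. (cmod (herm (pilot S l) (pilot_noise S m \<omega>)))\<^sup>2)
      (tau_p S * var_ul S)"
    using expectation_cmod_sum_indep[OF _ ind *(2,3), of "\<lambda>i. cnj (pilot S l $ i)"]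
    by (simp add: herm_def sum_distrib_right[symmetric])
qed

text \<open>Every correlated noise sample and every channel is a continuous function of its array,
  so its events lie in the sigma-algebra generated by that array. This holds for one fixed pilot
  \<open>l\<close> at a time.\<close>

lemma noise_chan_joint_indep:
  "indep_vars (\<lambda>_. borel)
    (case_sum (\<lambda>m \<omega>. herm (pilot S l) (pilot_noise S m \<omega>)) (\<lambda>(m, k). chan S m k)) UNIV"
proof (rule indep_vars_case_sum[OF _ chan_indep noise_chan_indep])
  show "indep_vars (\<lambda>_. borel) (\<lambda>m \<omega>. herm (pilot S l) (pilot_noise S m \<omega>)) UNIV"
    by (rule indep_vars_compose2[OF noise_indep])
      (intro borel_measurable_continuous_onI continuous_on_herm_right continuous_intros)
next
  fix m and C :: "complex set" assume C: "C \<in> sets borel"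
  have "(\<lambda>A :: complex^'t^'m. herm (pilot S l) (A $ m)) \<in> borel_measurable borel"
    by (intro borel_measurable_continuous_onI continuous_on_herm_right continuous_intros)
  from measurable_sets[OF this C]
  show "(\<lambda>\<omega>. herm (pilot S l) (pilot_noise S m \<omega>)) -` C \<inter> space (Pr S)
      \<in> sets (vimage_algebra (space (Pr S)) (\<lambda>\<omega>. (\<chi> m. pilot_noise S m \<omega>) :: complex^'t^'m) borel)"
    by (auto dest!: in_vimage_algebra[where f = "\<lambda>\<omega>. (\<chi> m. pilot_noise S m \<omega>) :: complex^'t^'m"
          and X = "space (Pr S)"] simp: vimage_def)
next
  fix i :: "'m \<times> 'k" and C :: "complex set" assume C: "C \<in> sets borel"
  have "(\<lambda>A :: complex^'k^'m. A $ fst i $ snd i) \<in> borel_measurable borel"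
    by (intro borel_measurable_continuous_onI continuous_intros)
  from measurable_sets[OF this C]
  show "(case i of (m, k) \<Rightarrow> chan S m k) -` C \<inter> space (Pr S)
      \<in> sets (vimage_algebra (space (Pr S)) (\<lambda>\<omega>. (\<chi> m k. chan S m k \<omega>) :: complex^'k^'m) borel)"
    by (cases i) (auto dest!: in_vimage_algebra[where f = "\<lambda>\<omega>. (\<chi> m k. chan S m k \<omega>) :: complex^'k^'m"
          and X = "space (Pr S)"] simp: vimage_def)
qed

text \<open>The product at access point m involves only its own noise sample and its own row of
  channels; these blocks are disjoint for distinct m.\<close>

lemma pilot_obs_chan_indep:
  "indep_vars (\<lambda>_. borel) (\<lambda>m \<omega>. cnj (pilot_obs S m l \<omega>) * chan S m k \<omega>) UNIV"
  by (rule indep_vars_group[OF noise_chan_joint_indep[of l],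
        where K = "\<lambda>m. insert (Inl m) (range (\<lambda>j. Inr (m, j)))"
        and f = "\<lambda>m x. cnj ((\<Sum>j\<in>copilot S l.
          complex_of_real (sqrt (pilot_pow S j) * tau_p S) * x (Inr (m, j))) + x (Inl m)) * x (Inr (m, k))"])
    (auto simp: disjoint_family_on_def pilot_obs_def)

text \<open>The coefficient $\alpha$ of $h_{m,k}$ in the observation $y^p_{m,l}$.\<close>

definition pilot_gain :: "'k \<Rightarrow> 'k \<Rightarrow> real" where
  "pilot_gain l k = (if k \<in> copilot S l then sqrt (pilot_pow S k) * tau_p S else 0)"

lemma pilot_obs_chan_moments:
  shows "has_bochner_integral (Pr S) (\<lambda>\<omega>. cnj (pilot_obs S m l \<omega>) * chan S m k \<omega>)
      (complex_of_real (pilot_gain l k * beta' S m k))" (is ?mean)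
    and "has_bochner_integral (Pr S) (\<lambda>\<omega>. (cmod (cnj (pilot_obs S m l \<omega>) * chan S m k \<omega>))\<^sup>2)
      ((pilot_gain l k)\<^sup>2 * ((beta S m k)\<^sup>2 + 2 * (los S m k)\<^sup>2 * beta S m k)
        + tau_p S * lambda' S m l * beta' S m k)" (is ?square)
proof -
  \<comment> \<open>Removing k changes nothing if k uses another pilot, and then the gain is zero,
    so both cases share one decomposition.\<close>
  define P where "P = copilot S l - {k}"
  let ?a = "\<lambda>j. complex_of_real (sqrt (pilot_pow S j) * tau_p S)"
  let ?N = "\<lambda>\<omega>. herm (pilot S l) (pilot_noise S m \<omega>)"
  let ?Z = "\<lambda>\<omega>. (\<Sum>j\<in>P. ?a j * chan S m j \<omega>) + ?N \<omega>"
  let ?G = "case_sum (\<lambda>m \<omega>. herm (pilot S l) (pilot_noise S m \<omega>)) (\<lambda>(m, k). chan S m k)"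
  let ?I = "insert (Inl m) ((\<lambda>j. Inr (m, j)) ` P) :: ('m + 'm \<times> 'k) set"
  have obs: "pilot_obs S m l \<omega> = complex_of_real (pilot_gain l k) * chan S m k \<omega> + ?Z \<omega>" for \<omega>
    unfolding pilot_obs_def pilot_gain_def P_def
    by (simp add: sum.remove[of "copilot S l" k])
  have "indep_var borel ((\<lambda>x. x (Inr (m, k))) \<circ> (\<lambda>\<omega>. restrict (\<lambda>i. ?G i \<omega>) {Inr (m, k)}))
      borel ((\<lambda>x. (\<Sum>j\<in>P. ?a j * x (Inr (m, j))) + x (Inl m)) \<circ> (\<lambda>\<omega>. restrict (\<lambda>i. ?G i \<omega>) ?I))"
    by (intro indep_var_compose[OF indep_var_restrict[OF noise_chan_joint_indep[of l]]])
      (auto simp: P_def)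
  then have ind: "indep_var borel (chan S m k) borel ?Z"
    by (simp add: comp_def)
  have "has_bochner_integral (Pr S) ?Z ((\<Sum>j\<in>P. ?a j * 0) + 0)"
    by (intro has_bochner_integral_add has_bochner_integral_sum has_bochner_integral_mult_right
        chan_moments correlated_noise_moments)
  then have Z0: "has_bochner_integral (Pr S) ?Z 0" by simp
  \<comment> \<open>Noise enters with weight 1 and channel j with its pilot amplitude. All means are
    zero, so the second moment of Z is the weighted sum of variances.\<close>
  have "has_bochner_integral (Pr S)
      (\<lambda>\<omega>. (cmod (\<Sum>i\<in>?I. case_sum (\<lambda>_. 1) (\<lambda>(m, j). ?a j) i * ?G i \<omega>))\<^sup>2)
      ((cmod (\<Sum>i\<in>?I. case_sum (\<lambda>_. 1) (\<lambda>(m, j). ?a j) i * (\<lambda>_. 0) i))\<^sup>2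
        + (\<Sum>i\<in>?I. (cmod (case_sum (\<lambda>_. 1) (\<lambda>(m, j). ?a j) i))\<^sup>2
            * (case_sum (\<lambda>_. tau_p S * var_ul S) (\<lambda>(m, j). beta' S m j) i - (cmod ((\<lambda>_. 0) i))\<^sup>2)))"
    by (intro expectation_cmod_sum_indep indep_vars_subset[OF noise_chan_joint_indep])
      (auto intro: chan_moments correlated_noise_moments)
  moreover have "(\<Sum>i\<in>?I. case_sum (\<lambda>_. 1) (\<lambda>(m, j). ?a j) i * ?G i \<omega>) = ?Z \<omega>" for \<omega>
    by (subst sum.insert) (auto simp: sum.reindex inj_on_def)
  moreover have "(\<Sum>i\<in>?I. (cmod (case_sum (\<lambda>_. 1) (\<lambda>(m, j). ?a j) i))\<^sup>2
            * (case_sum (\<lambda>_. tau_p S * var_ul S) (\<lambda>(m, j). beta' S m j) i - (cmod ((\<lambda>_. 0 :: complex) i))\<^sup>2))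
      = tau_p S * var_ul S + (\<Sum>j\<in>P. pilot_pow S j * (tau_p S)\<^sup>2 * beta' S m j)"
    using pilot_pow_pos
    by (subst sum.insert)
      (auto simp: sum.reindex inj_on_def norm_mult power_mult_distrib less_imp_le)
  ultimately have Z2: "has_bochner_integral (Pr S) (\<lambda>\<omega>. (cmod (?Z \<omega>))\<^sup>2)
      (tau_p S * var_ul S + (\<Sum>j\<in>P. pilot_pow S j * (tau_p S)\<^sup>2 * beta' S m j))"
    by (simp only:) simp
  \<comment> \<open>This is the second moment of the whole observation; taking away the share of
    user k leaves that of Z. The part -\<alpha>^2 \<open>beta'\<close>^2 this produces cancels the
    squared second moment inside E|h|^4.\<close>
  have "tau_p S * lambda' S m l
      = tau_p S * var_ul S + (\<Sum>j\<in>copilot S l. pilot_pow S j * (tau_p S)\<^sup>2 * beta' S m j)"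
    by (simp add: lambda'_def sum_distrib_left algebra_simps power2_eq_square)
  also have "\<dots> = (tau_p S * var_ul S + (\<Sum>j\<in>P. pilot_pow S j * (tau_p S)\<^sup>2 * beta' S m j))
      + (pilot_gain l k)\<^sup>2 * beta' S m k"
    using pilot_pow_pos unfolding P_def
    by (simp add: pilot_gain_def sum.remove[of "copilot S l" k] power_mult_distrib less_imp_le)
  finally have z: "tau_p S * var_ul S + (\<Sum>j\<in>P. pilot_pow S j * (tau_p S)\<^sup>2 * beta' S m j)
      = tau_p S * lambda' S m l - (pilot_gain l k)\<^sup>2 * beta' S m k" by simp
  note moments = moments_cnj_mult_indep[OF ind chan_moments(1) Z0 chan_moments(2,3) Z2[unfolded z],
      of "pilot_gain l k"]
  show ?mean using moments(1) unfolding obs .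
  show ?square using moments(2) unfolding obs by (simp add: algebra_simps power2_eq_square)
qed

section \<open>MR precoding\<close>

lemma mr_norm_nonneg: "mr_norm S m l \<ge> 0"
  by (simp add: mr_norm_def dl_pow_nonneg)

lemma beta'_pos: "beta' S m k > 0"
  by (simp add: beta'_def beta_pos add_pos_nonneg)

lemma lambda'_pos: "lambda' S m k > 0"
  unfolding lambda'_def
  by (intro add_nonneg_pos sum_nonneg mult_nonneg_nonneg var_ul_pos)
    (simp_all add: less_imp_le pilot_pow_pos beta'_pos tau_p_def)

lemma copilot_commute: "l \<in> copilot S k \<longleftrightarrow> k \<in> copilot S l"
  by (auto simp: copilot_def)

section \<open>Diagonal forms of the matrices and weights of the precoder\<close>

lemma R'_mat_eq: "R'_mat S k = diag_mat (\<chi> m. beta' S m k)"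
  by (simp add: R'_mat_def R_mat_def L_mat_def diag_mat_add beta'_def)

lemma Lambda'_mat_eq: "Lambda'_mat S k = diag_mat (\<chi> m. 1 / lambda' S m k)"
  using lambda'_pos by (simp add: Lambda'_mat_def matrix_inv_diag_mat less_imp_neq[symmetric])

lemmas system_mat_eqs = R_mat_def L_mat_def R'_mat_eq Lambda'_mat_eq Omega'_mat_def D_mat_def
  sqrt_D_mat_def diag_mat_mult diag_mat_add diag_mat_scaleR trace_diag_mat

text \<open>The weights a_m: precoder scaling times LMMSE factor. Both are real, so they pass
  through the conjugation in \<open>herm\<close>.\<close>

definition mr_weight :: "'m \<Rightarrow> 'k \<Rightarrow> real" where
  "mr_weight m l = sqrt (mr_norm S m l) * (sqrt (pilot_pow S l) * beta' S m l / lambda' S m l)"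

lemma herm_mr_lmmse_chan:
  "herm (mr_lmmse S l \<omega>) (chan_vec S k \<omega>)
    = (\<Sum>m\<in>UNIV. complex_of_real (mr_weight m l) * (cnj (pilot_obs S m l \<omega>) * chan S m k \<omega>))"
proof -
  have "mr_lmmse S l \<omega> $ m = complex_of_real (mr_weight m l) * pilot_obs S m l \<omega>" for m
    by (simp add: mr_lmmse_def sqrt_D_mat_def cmat_diag_mat_mult_vec lmmse_vec_def lmmse_def
        mr_weight_def)
  then show ?thesis by (simp add: herm_def chan_vec_def mult.assoc)
qed

lemma mr_weight_square:
  "(mr_weight m l)\<^sup>2 = mr_norm S m l * (pilot_pow S l * (beta' S m l)\<^sup>2 / (lambda' S m l)\<^sup>2)"
  using mr_norm_nonneg pilot_pow_pos[of l]
  by (simp add: mr_weight_def power_mult_distrib power_divide)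

lemma mean_herm_mr_lmmse:
  "has_bochner_integral (Pr S) (\<lambda>\<omega>. herm (mr_lmmse S l \<omega>) (chan_vec S k \<omega>))
    (complex_of_real (\<Sum>m\<in>UNIV. mr_weight m l * (pilot_gain l k * beta' S m k)))"
  unfolding herm_mr_lmmse_chan of_real_sum of_real_mult[of "mr_weight _ _"]
  by (intro has_bochner_integral_sum has_bochner_integral_mult_right pilot_obs_chan_moments)

lemma square_herm_mr_lmmse:
  "expectation (\<lambda>\<omega>. (cmod (herm (mr_lmmse S l \<omega>) (chan_vec S k \<omega>)))\<^sup>2)
    = (\<Sum>m\<in>UNIV. mr_weight m l * (pilot_gain l k * beta' S m k))\<^sup>2
      + (\<Sum>m\<in>UNIV. (mr_weight m l)\<^sup>2 *
          ((pilot_gain l k)\<^sup>2 * ((beta S m k)\<^sup>2 + 2 * (los S m k)\<^sup>2 * beta S m k)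
            + tau_p S * lambda' S m l * beta' S m k - (pilot_gain l k * beta' S m k)\<^sup>2))"
  unfolding herm_mr_lmmse_chan
  by (subst expectation_cmod_sum_indep[OF finite pilot_obs_chan_indep pilot_obs_chan_moments,
        THEN has_bochner_integral_integral_eq])
    (simp flip: of_real_mult of_real_sum)

lemma expectation_herm_mr_lmmse:
  "expectation (\<lambda>\<omega>. herm (mr_lmmse S k \<omega>) (chan_vec S k \<omega>))
    = complex_of_real (pilot_pow S k * tau_p S * trace (sqrt_D_mat S k ** Omega'_mat S k))"
proof -
  have "k \<in> copilot S k" by (simp add: copilot_def)
  moreover have "sqrt (pilot_pow S k) * sqrt (pilot_pow S k) = pilot_pow S k"
    using pilot_pow_pos[of k] by simp
  ultimately have "mr_weight m k * (pilot_gain k k * beta' S m k)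
      = pilot_pow S k * tau_p S
        * (sqrt (mr_norm S m k) * (beta' S m k * (1 / lambda' S m k) * beta' S m k))" for m
    by (simp add: mr_weight_def pilot_gain_def field_simps)
  then show ?thesis
    unfolding has_bochner_integral_integral_eq[OF mean_herm_mr_lmmse]
    by (simp add: system_mat_eqs sum_distrib_left)
qed

text \<open>Each scalar sum matches one trace: tau_p \<open>lambda'\<close> \<open>beta'\<close>
  gives the direct term, the excess of the fourth moment gives R^2 + 2 L R, the squared mean gives
  the squared trace, and the subtracted squared means give the trace of the square.\<close>

lemma expectation_square_herm_mr_lmmse:
  "expectation (\<lambda>\<omega>. (cmod (herm (mr_lmmse S l \<omega>) (chan_vec S k \<omega>)))\<^sup>2)
    = pilot_pow S l * tau_p S * trace (D_mat S l ** R'_mat S k ** Omega'_mat S l)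
      + (if l \<in> copilot S k then T2 S k l else 0)"
proof -
  note pos = lambda'_pos[of _ l, THEN less_imp_neq, symmetric]
  \<comment> \<open>The squared weight carries 1 / \<open>lambda'\<close>^2; one factor is cancelled
    here, and the other is the \<open>Lambda'_mat\<close> inside \<open>Omega'_mat\<close>.\<close>
  have direct: "(mr_weight m l)\<^sup>2 * (tau_p S * lambda' S m l * beta' S m k)
      = pilot_pow S l * tau_p S * (mr_norm S m l * beta' S m k
          * (beta' S m l * (1 / lambda' S m l) * beta' S m l))" for m
    using pos[of m] unfolding mr_weight_square by (simp add: power2_eq_square field_simps)
  show ?thesis
  proof (cases "l \<in> copilot S k")
    case False
    then have "pilot_gain l k = 0" by (simp add: pilot_gain_def copilot_commute)
    then show ?thesis using False
      unfolding square_herm_mr_lmmse by (simp add: direct system_mat_eqs sum_distrib_left)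
  next
    case True
    then have g: "pilot_gain l k = sqrt (pilot_pow S k) * tau_p S"
      by (simp add: pilot_gain_def copilot_commute)
    have g2: "(pilot_gain l k)\<^sup>2 = pilot_pow S k * (tau_p S)\<^sup>2"
      using pilot_pow_pos[of k] by (simp add: g power_mult_distrib)
    let ?c = "pilot_pow S k * pilot_pow S l * (tau_p S)\<^sup>2"
    let ?b = "\<lambda>m. beta' S m k * (1 / lambda' S m l) * beta' S m l"
    have "(\<Sum>m\<in>UNIV. mr_weight m l * (pilot_gain l k * beta' S m k))
        = (sqrt (pilot_pow S k) * sqrt (pilot_pow S l) * tau_p S)
          * (\<Sum>m\<in>UNIV. sqrt (mr_norm S m l) * ?b m)"
      unfolding sum_distrib_left g by (intro sum.cong) (simp_all add: mr_weight_def field_simps)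
    then have mean: "(\<Sum>m\<in>UNIV. mr_weight m l * (pilot_gain l k * beta' S m k))\<^sup>2
        = ?c * (\<Sum>m\<in>UNIV. sqrt (mr_norm S m l) * ?b m)\<^sup>2"
      using pilot_pow_pos[of k] pilot_pow_pos[of l] by (simp add: power_mult_distrib)
    \<comment> \<open>Here both factors 1 / \<open>lambda'\<close> survive, one inside
      \<open>Omega'_mat\<close> and one as the separate \<open>Lambda'_mat\<close>. Leaving
      \<open>x\<close> free keeps the fourth-moment excess intact under rewriting.\<close>
    have fourth: "(mr_weight m l)\<^sup>2 * ((pilot_gain l k)\<^sup>2 * x)
        = ?c * (mr_norm S m l * (beta' S m l * (1 / lambda' S m l) * beta' S m l)
            * (1 / lambda' S m l) * x)" for m x
      unfolding mr_weight_square g2 by (simp add: power2_eq_square)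
    have diag: "(mr_weight m l)\<^sup>2 * (pilot_gain l k * beta' S m k)\<^sup>2
        = ?c * (mr_norm S m l * (?b m * ?b m))" for m
      unfolding mr_weight_square power_mult_distrib g2 by (simp add: power2_eq_square)
    have tr_direct: "pilot_pow S l * tau_p S * trace (D_mat S l ** R'_mat S k ** Omega'_mat S l)
        = (\<Sum>m\<in>UNIV. (mr_weight m l)\<^sup>2 * (tau_p S * lambda' S m l * beta' S m k))"
      unfolding direct by (simp add: system_mat_eqs sum_distrib_left)
    have tr_fourth: "?c * trace (D_mat S l ** Omega'_mat S l ** Lambda'_mat S l **
          (R_mat S k ** R_mat S k + 2 *\<^sub>R (L_mat S k ** R_mat S k)))
        = (\<Sum>m\<in>UNIV. (mr_weight m l)\<^sup>2 *
            ((pilot_gain l k)\<^sup>2 * ((beta S m k)\<^sup>2 + 2 * (los S m k)\<^sup>2 * beta S m k)))"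
      unfolding fourth by (simp add: system_mat_eqs sum_distrib_left power2_eq_square mult.assoc)
    let ?A = "R'_mat S k ** Lambda'_mat S l ** R'_mat S l"
    have tr_diag: "?c * trace (D_mat S l ** (?A ** ?A))
        = (\<Sum>m\<in>UNIV. (mr_weight m l)\<^sup>2 * (pilot_gain l k * beta' S m k)\<^sup>2)"
      unfolding diag by (simp add: system_mat_eqs sum_distrib_left)
    have tr_mean: "\<bar>trace (sqrt_D_mat S l ** ?A)\<bar>\<^sup>2 = (\<Sum>m\<in>UNIV. sqrt (mr_norm S m l) * ?b m)\<^sup>2"
      by (simp add: system_mat_eqs)
    have "T2 S k l = ?c * trace (D_mat S l ** Omega'_mat S l ** Lambda'_mat S l **
          (R_mat S k ** R_mat S k + 2 *\<^sub>R (L_mat S k ** R_mat S k)))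
        + ?c * \<bar>trace (sqrt_D_mat S l ** ?A)\<bar>\<^sup>2 - ?c * trace (D_mat S l ** (?A ** ?A))"
      by (simp only: T2_def Let_def distrib_left right_diff_distrib)
    then show ?thesis
      unfolding square_herm_mr_lmmse mean if_P[OF True] tr_direct tr_fourth tr_diag tr_mean
      by (simp only: distrib_left[of "(mr_weight _ _)\<^sup>2"] right_diff_distrib[of "(mr_weight _ _)\<^sup>2"]
          sum.distrib sum_subtractf)
  qed
qed

text \<open>Summing the second moments over all users, the conditional term restricts
  \<open>T2\<close> to the users that share the pilot of \<open>k\<close>.\<close>

lemma sinr_mr_lmmse:
  "sinr_dl_coh S (mr_lmmse S) k =
    (pilot_pow S k)\<^sup>2 * (tau_p S)\<^sup>2 * \<bar>trace (sqrt_D_mat S k ** Omega'_mat S k)\<bar>\<^sup>2 /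
    ((\<Sum>l\<in>UNIV. pilot_pow S l * tau_p S * trace (D_mat S l ** R'_mat S k ** Omega'_mat S l))
      + (\<Sum>l\<in>copilot S k. T2 S k l)
      - (pilot_pow S k)\<^sup>2 * (tau_p S)\<^sup>2 * \<bar>trace (sqrt_D_mat S k ** Omega'_mat S k)\<bar>\<^sup>2
      + var_dl S)"
  unfolding sinr_dl_coh_def expectation_herm_mr_lmmse expectation_square_herm_mr_lmmse Let_def
    norm_of_real
  by (simp add: sum.distrib power_mult_distrib sum.If_cases del: of_real_mult)

end

theorem theorem5:
  fixes S :: "('w, 'm::finite, 'k::finite, 't::finite) cf_system"
  assumes "cf_downlink S"
  shows "(\<forall>k. prob_space.expectation (Pr S) (\<lambda>\<omega>. herm (mr_lmmse S k \<omega>) (chan_vec S k \<omega>)) =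
            complex_of_real (pilot_pow S k * tau_p S * trace (sqrt_D_mat S k ** Omega'_mat S k))) \<and>
         (\<forall>k l. prob_space.expectation (Pr S)
                  (\<lambda>\<omega>. (cmod (herm (mr_lmmse S l \<omega>) (chan_vec S k \<omega>)))\<^sup>2) =
            pilot_pow S l * tau_p S * trace (D_mat S l ** R'_mat S k ** Omega'_mat S l)
              + (if l \<in> copilot S k then T2 S k l else 0)) \<and>
         (\<forall>k. sinr_dl_coh S (mr_lmmse S) k =
            (pilot_pow S k)\<^sup>2 * (tau_p S)\<^sup>2 * \<bar>trace (sqrt_D_mat S k ** Omega'_mat S k)\<bar>\<^sup>2 /
            ((\<Sum>l\<in>UNIV. pilot_pow S l * tau_p S * trace (D_mat S l ** R'_mat S k ** Omega'_mat S l))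
              + (\<Sum>l\<in>copilot S k. T2 S k l)
              - (pilot_pow S k)\<^sup>2 * (tau_p S)\<^sup>2 * \<bar>trace (sqrt_D_mat S k ** Omega'_mat S k)\<bar>\<^sup>2
              + var_dl S))"
  using cf_downlink.expectation_herm_mr_lmmse[OF assms]
    cf_downlink.expectation_square_herm_mr_lmmse[OF assms] cf_downlink.sinr_mr_lmmse[OF assms]
  by blast

end
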